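(* For every $n\ge 1$ and every permutation $\pi$ of $[n]$, we have $pbid(\pi)\le g(\pi)-\lceil c_2^{\emptyset}(G(\pi))/2\rceil$, where $c_2^{\emptyset}(G(\pi))$ denotes the number of $2$-cycles of $G(\pi)$ other than the leftmost cycle.
   Context: Permutations of $[n]=\{1,\dots,n\}$ are written as sequences $\pi=\langle\pi_1\,\pi_2\cdots\pi_n\rangle$ with $\pi_i=\pi(i)$; products are compositions applied right to left, so $(\pi\sigma)_i=\pi_{\sigma(i)}$; $\iota=\langle 1\,2\cdots n\rangle$ is the identity. For $1\le i<j\le k<\ell\le n+1$, the block-interchange $\beta(i,j,k,\ell)$ is the permutation $\langle 1\cdots i-1\;\; k\cdots \ell-1\;\; j\cdots k-1\;\; i\cdots j-1\;\; \ell\cdots n\rangle$, so that $\pi\beta(i,j,k,\ell)$ is obtained from $\pi$ by exchanging the blocks $\pi_i\cdots\pi_{j-1}$ and $\pi_k\cdots\pi_{\ell-1}$. A prefix block-interchange is a block-interchange with $i=1$. $pbid(\pi)$ denotes the minimum $t\ge 0$ such that there are prefix block-interchanges $\beta_1,\dots,\beta_t$ with $\pi\beta_1\cdots\beta_t=\iota$. Breakpoint graph: let $\pi'=(\pi'_0,\dots,\pi'_{2n+1})$ with $\pi'_0=0$, $\pi'_{2n+1}=2n+1$ and $(\pi'_{2i-1},\pi'_{2i})=(2\pi_i-1,2\pi_i)$ for $1\le i\le n$. $G(\pi)$ is the graph on vertex set $\{0,\dots,2n+1\}$ (vertex $\pi'_p$ being at position $p$) with black edges $\{\pi'_{2i},\pi'_{2i+1}\}$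 for $0\le i\le n$ and grey edges $\{2i,2i+1\}$ for $0\le i\le n$. It decomposes uniquely into edge-disjoint cycles alternating black and grey edges; the length of a cycle is its number of black edges, a $k$-cycle is a cycle of length $k$. $c(G(\pi))$ is the number of cycles and $c_k(G(\pi))$ the number of $k$-cycles. The leftmost cycle is the cycle containing vertex $0$. Let $f(\pi)=0$ if $\pi_1=1$ and $f(\pi)=1$ otherwise, and $g(\pi)=\frac{n+1+c(G(\pi))}{2}-c_1(G(\pi))-f(\pi)$. *)

theory Defs
  imports Complex_Main "HOL-Combinatorics.Permutations"
begin

text \<open>A permutation of $[n]$ is a function \<^term>\<open>\<pi>\<close> with \<^prop>\<open>\<pi> permutes {1..n}\<close>, so it fixes
  every number outside \<^term>\<open>{1..n}\<close>. Products of permutations are compositions.\<close>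

definition block_interchange :: "nat \<Rightarrow> nat \<Rightarrow> nat \<Rightarrow> nat \<Rightarrow> nat \<Rightarrow> nat \<Rightarrow> nat" where
  "block_interchange n i j k l p =
     (if p \<in> {1..n}
      then ([1..<i] @ [k..<l] @ [j..<k] @ [i..<j] @ [l..<n+1]) ! (p - 1)
      else p)"

definition prefix_block_interchanges :: "nat \<Rightarrow> (nat \<Rightarrow> nat) set" where
  "prefix_block_interchanges n =
     {block_interchange n 1 j k l | j k l. 1 < j \<and> j \<le> k \<and> k < l \<and> l \<le> n + 1}"

definition pbi_sorts :: "nat \<Rightarrow> (nat \<Rightarrow> nat) \<Rightarrow> (nat \<Rightarrow> nat) list \<Rightarrow> bool" where
  "pbi_sorts n \<pi> \<beta>s \<longleftrightarrow> set \<beta>s \<subseteq> prefix_block_interchanges n \<and> foldl (\<circ>) \<pi> \<beta>s = id"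

text \<open>The minimum exists by \<open>pbid_attained\<close> below.\<close>

definition pbid :: "nat \<Rightarrow> (nat \<Rightarrow> nat) \<Rightarrow> nat" where
  "pbid n \<pi> = (LEAST t. \<exists>\<beta>s. length \<beta>s = t \<and> pbi_sorts n \<pi> \<beta>s)"

definition doubled :: "nat \<Rightarrow> (nat \<Rightarrow> nat) \<Rightarrow> nat \<Rightarrow> nat" where
  "doubled n \<pi> p =
     (if p = 0 then 0
      else if p = 2 * n + 1 then 2 * n + 1
      else if odd p then 2 * \<pi> ((p + 1) div 2) - 1
      else 2 * \<pi> (p div 2))"

definition black_edges :: "nat \<Rightarrow> (nat \<Rightarrow> nat) \<Rightarrow> nat set set" where
  "black_edges n \<pi> = {{doubled n \<pi> (2 * i), doubled n \<pi> (2 * i + 1)} | i. i \<le> n}"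

definition grey_edges :: "nat \<Rightarrow> nat set set" where
  "grey_edges n = {{2 * i, 2 * i + 1} | i. i \<le> n}"

text \<open>An alternating cycle is traversed by a list of distinct vertices $v_0, \dots, v_{2k-1}$ with
  black edges $\{v_{2i}, v_{2i+1}\}$ and grey edges $\{v_{2i+1}, v_{2i+2}\}$, indices modulo $2k$.
  The cycle itself is the pair of its set of black edges and its set of grey edges, so that it does
  not depend on the starting point and direction of the traversal. The two colours are kept apart
  because in a 1-cycle the black and the grey edge join the same two vertices.\<close>

definition black_part :: "nat list \<Rightarrow> nat set set" where
  "black_part vs = {{vs ! (2 * i), vs ! (2 * i + 1)} | i. 2 * i < length vs}"

definition grey_part :: "nat list \<Rightarrow> nat set set" where
  "grey_part vs =
     {{vs ! (2 * i + 1), vs ! ((2 * i + 2) mod length vs)} | i. 2 * i < length vs}"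

definition bg_cycles :: "nat \<Rightarrow> (nat \<Rightarrow> nat) \<Rightarrow> (nat set set \<times> nat set set) set" where
  "bg_cycles n \<pi> = {(black_part vs, grey_part vs) | vs.
     vs \<noteq> [] \<and> even (length vs) \<and> distinct vs \<and>
     black_part vs \<subseteq> black_edges n \<pi> \<and> grey_part vs \<subseteq> grey_edges n}"

definition cycle_length :: "nat set set \<times> nat set set \<Rightarrow> nat" where
  "cycle_length C = card (fst C)"

definition cycle_vertices :: "nat set set \<times> nat set set \<Rightarrow> nat set" where
  "cycle_vertices C = \<Union> (fst C \<union> snd C)"

definition is_leftmost :: "nat set set \<times> nat set set \<Rightarrow> bool" where
  "is_leftmost C \<longleftrightarrow> 0 \<in> cycle_vertices C"

definition num_cycles :: "nat \<Rightarrow> (nat \<Rightarrow> nat) \<Rightarrow> nat" where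
  "num_cycles n \<pi> = card (bg_cycles n \<pi>)"

definition num_k_cycles :: "nat \<Rightarrow> nat \<Rightarrow> (nat \<Rightarrow> nat) \<Rightarrow> nat" where
  "num_k_cycles k n \<pi> = card {C \<in> bg_cycles n \<pi>. cycle_length C = k}"

definition num_nonleftmost_2_cycles :: "nat \<Rightarrow> (nat \<Rightarrow> nat) \<Rightarrow> nat" where
  "num_nonleftmost_2_cycles n \<pi> =
     card {C \<in> bg_cycles n \<pi>. cycle_length C = 2 \<and> \<not> is_leftmost C}"

definition f_val :: "(nat \<Rightarrow> nat) \<Rightarrow> nat" where
  "f_val \<pi> = (if \<pi> 1 = 1 then 0 else 1)"

definition g_val :: "nat \<Rightarrow> (nat \<Rightarrow> nat) \<Rightarrow> real" where
  "g_val n \<pi> = (real n + 1 + real (num_cycles n \<pi>)) / 2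
                 - real (num_k_cycles 1 n \<pi>) - real (f_val \<pi>)"

lemma transpose_prefix_block_interchange:
  assumes "2 \<le> k" "k \<le> n"
  shows "transpose 1 k \<in> prefix_block_interchanges n"
proof -
  have "block_interchange n 1 2 k (k + 1) p = transpose 1 k p" for p
    using assms
    by (auto simp: block_interchange_def transpose_def nth_append nth_Cons' upt_rec[of 1 2]
        upt_rec[of k "Suc k"] simp del: upt_Suc)
  then have "transpose 1 k = block_interchange n 1 2 k (k + 1)"
    by auto
  then show ?thesis
    using assms unfolding prefix_block_interchanges_def by fastforce
qed

lemma transpose_sorts_step:
  assumes "a \<in> {1..n}" "b \<in> {1..n}"
  shows "\<exists>\<beta>s. set \<beta>s \<subseteq> prefix_block_interchanges n \<and>
           (\<forall>\<sigma> :: nat \<Rightarrow> nat. foldl (\<circ>) \<sigma> \<beta>s = \<sigma> \<circ> transpose a b)"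
proof -
  consider "a = b" | "a \<noteq> b" "a = 1" | "a \<noteq> b" "b = 1" | "a \<noteq> b" "2 \<le> a" "2 \<le> b"
    using assms by fastforce
  then show ?thesis
  proof cases
    case 1
    then show ?thesis by (intro exI[of _ "[]"]) auto
  next
    case 2
    then show ?thesis using transpose_prefix_block_interchange[of b n] assms
      by (intro exI[of _ "[transpose 1 b]"]) auto
  next
    case 3
    then show ?thesis using transpose_prefix_block_interchange[of a n] assms
      by (intro exI[of _ "[transpose 1 a]"]) (auto simp: transpose_commute)
  next
    case 4
    then have "transpose 1 a \<circ> transpose 1 b \<circ> transpose 1 a = transpose a b"
      by (auto simp: fun_eq_iff transpose_def)
    then have "\<sigma> \<circ> transpose 1 a \<circ> transpose 1 b \<circ> transpose 1 a = \<sigma> \<circ> transpose a b" for \<sigma> :: "nat \<Rightarrow> nat"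
      by (metis comp_assoc)
    then show ?thesis using 4 transpose_prefix_block_interchange[of _ n] assms
      by (intro exI[of _ "[transpose 1 a, transpose 1 b, transpose 1 a]"]) auto
  qed
qed

lemma pbi_sorts_exists:
  assumes "\<pi> permutes {1..n}"
  shows "\<exists>\<beta>s. pbi_sorts n \<pi> \<beta>s"
  using finite_atLeastAtMost assms
proof (induction rule: permutes_rev_induct)
  case id
  show ?case by (intro exI[of _ "[]"]) (auto simp: pbi_sorts_def)
next
  case (swap a b p)
  then obtain \<beta>s where \<beta>s: "pbi_sorts n p \<beta>s" by blast
  obtain \<gamma>s where \<gamma>s: "set \<gamma>s \<subseteq> prefix_block_interchanges n"
      "\<And>\<sigma> :: nat \<Rightarrow> nat. foldl (\<circ>) \<sigma> \<gamma>s = \<sigma> \<circ> transpose a b"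
    using transpose_sorts_step swap by metis
  have "foldl (\<circ>) (p \<circ> transpose a b) \<gamma>s = p"
    unfolding \<gamma>s(2) by (simp add: fun_eq_iff)
  then have "pbi_sorts n (p \<circ> transpose a b) (\<gamma>s @ \<beta>s)"
    using \<beta>s \<gamma>s(1) by (simp add: pbi_sorts_def)
  then show ?case by blast
qed

lemma pbid_attained:
  assumes "\<pi> permutes {1..n}"
  shows "\<exists>\<beta>s. length \<beta>s = pbid n \<pi> \<and> pbi_sorts n \<pi> \<beta>s"
  unfolding pbid_def by (rule LeastI_ex) (use pbi_sorts_exists[OF assms] in blast)

end

theory Submission
  imports Defs "HOL-Combinatorics.Orbits"
begin

text \<open>Label the black edge whose left end is \<open>2u\<close> by \<open>u\<close>; the cycles of the breakpoint graph become the
  orbits of the permutation \<open>left_of_succ \<pi>\<close> of \<open>{0..n}\<close>, and a prefix block-interchange multiplies it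
  by two transpositions. Since the number of 1-cycles plus \<open>f(\<pi>)\<close> is one more than the number of
  nonzero fixed points, the bound of the theorem is a \<open>potential\<close> without case distinction, and it
  suffices that some move lowers it by at least 1.

  If \<open>\<pi>\<^sub>1 \<noteq> 1\<close>, the predecessor of \<open>0\<close> can be split off its cycle together with a second nonzero
  element. If \<open>\<pi>\<^sub>1 = 1\<close>, one element is split off a nontrivial cycle, a 2-cycle if there is one, while
  the 1-cycle of \<open>0\<close> is merged into another nontrivial cycle. The positions needed for these moves
  are found by telescoping the sum of \<open>\<pi>\<^sub>i\<^sub>+\<^sub>1 - \<pi>\<^sub>i\<close> over an interval.\<close>

section \<open>Detaching a point from its cycle\<close>

text \<open>For injective \<open>f\<close> at most two values change: \<open>x\<close> becomes fixed
  and its predecessor is sent to \<open>f x\<close>. Merging a fixed point into a cycle is treated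
  as the inverse operation.\<close>

definition detach :: "'a \<Rightarrow> ('a \<Rightarrow> 'a) \<Rightarrow> 'a \<Rightarrow> 'a" where
  "detach x f = transpose x (f x) \<circ> f"

definition orbits :: "'a set \<Rightarrow> ('a \<Rightarrow> 'a) \<Rightarrow> 'a set set" where
  "orbits S f = orbit f ` S"

lemma detach_permutes:
  assumes "f permutes S" "x \<in> S"
  shows "detach x f permutes S"
  using assms unfolding detach_def
  by (intro permutes_compose permutes_swap_id) (auto simp: permutes_in_image)

lemma detach_self [simp]: "detach x f x = x"
  by (simp add: detach_def)

lemma detach_other:
  assumes "inj f" "y \<noteq> x"
  shows "detach x f y = (if f y = x then f x else f y)"
  using assms by (auto simp: detach_def transpose_def dest: injD)

lemma orbit_detach_self: "orbit (detach x f) x = {x}"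
proof -
  have "y = x" if "y \<in> orbit (detach x f) x" for y
    using that by induction auto
  moreover have "x \<in> orbit (detach x f) x"
    by (metis detach_self orbit.base)
  ultimately show ?thesis by auto
qed

lemma orbit_detach:
  assumes f: "inj f" and "y \<noteq> x" "f x \<noteq> x"
  shows "orbit (detach x f) y = orbit f y - {x}"
proof (intro equalityI subsetI)
  fix z assume "z \<in> orbit (detach x f) y"
  then show "z \<in> orbit f y - {x}"
  proof induction
    case base
    then show ?case
      using assms by (auto simp: detach_other[OF f] intro: orbit.intros)
  next
    case (step z)
    then show ?case
      using assms by (auto simp: detach_other[OF f] intro: orbit.intros)
  qed
next
  fix z assume z: "z \<in> orbit f y - {x}"
  have key: "detach x f w \<in> orbit (detach x f) y \<Longrightarrow> w \<noteq> x \<Longrightarrow>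
      f w \<noteq> x \<and> f w \<in> orbit (detach x f) y \<or> f w = x \<and> f x \<in> orbit (detach x f) y" for w
    by (auto simp: detach_other[OF f] split: if_splits)
  from z have "z \<in> orbit f y" by simp
  \<comment> \<open>The new map started at \<open>y\<close> never visits \<open>x\<close>, so at
    \<open>x\<close> the invariant says instead that \<open>f x\<close> has been reached.\<close>
  then have "z \<noteq> x \<and> z \<in> orbit (detach x f) y \<or> z = x \<and> f x \<in> orbit (detach x f) y"
  proof induction
    case base
    show ?case by (rule key) (use assms in \<open>auto intro: orbit.intros\<close>)
  next
    case (step z)
    then show ?case
      using assms(3) key[of z] orbit.step[of z "detach x f" y] by metis
  qed
  then show "z \<in> orbit (detach x f) y" using z by auto
qed

lemma self_in_orbit:
  assumes "f permutes S" "finite S"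
  shows "x \<in> orbit f x"
  by (meson assms permutation_permutes permutation_self_in_orbit)

lemma orbit_eq_iff:
  assumes "f permutes S" "finite S"
  shows "orbit f x = orbit f y \<longleftrightarrow> x \<in> orbit f y"
  using assms by (metis orbit_cyclic_eq3 cyclic_on_orbit self_in_orbit permutation_permutes)

lemma orbits_disjoint:
  assumes "f permutes S" "finite S" "O1 \<in> orbits S f" "O2 \<in> orbits S f" "z \<in> O1" "z \<in> O2"
  shows "O1 = O2"
  using assms unfolding orbits_def by (metis (no_types, lifting) imageE orbit_eq_iff)

lemma finite_orbit_permutes:
  assumes "f permutes S" "finite S" "x \<in> S"
  shows "finite (orbit f x)"
  using assms by (meson finite_subset permutes_orbit_subset)

text \<open>Removing \<open>x\<close> affects only the orbit containing it; the rest of that orbit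
  is nonempty, being the new orbit of \<open>f x\<close>.\<close>

lemma orbits_detach:
  assumes f: "f permutes S" "finite S" and x: "x \<in> S" "f x \<noteq> x"
  shows "orbits S (detach x f) = insert {x} (insert (orbit f x - {x}) (orbits S f - {orbit f x}))"
proof -
  note inj = permutes_inj[OF f(1)]
  have 1: "orbit (detach x f) y = (if y = x then {x} else orbit f y - {x})" for y
    using orbit_detach[OF inj _ x(2)] orbit_detach_self[of x f] by auto
  have 2: "orbit f y - {x} = orbit f y \<and> orbit f y \<noteq> orbit f x" if "y \<notin> orbit f x" for y
  proof -
    have "orbit f y \<noteq> orbit f x" using self_in_orbit[OF f, of y] that by blast
    moreover from this have "x \<notin> orbit f y" using orbit_eq_iff[OF f, of x y] by blast
    ultimately show ?thesis by blast
  qed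
  have 3: "orbit f y = orbit f x" if "y \<in> orbit f x" for y
    using orbit_eq_iff[OF f] that by blast
  have 4: "f x \<in> S" "f x \<in> orbit f x"
    using x f by (auto simp: permutes_in_image intro: orbit.base)
  show ?thesis
  proof (intro equalityI subsetI)
    fix Q assume "Q \<in> orbits S (detach x f)"
    then obtain y where y: "y \<in> S" "Q = orbit (detach x f) y" by (auto simp: orbits_def)
    show "Q \<in> insert {x} (insert (orbit f x - {x}) (orbits S f - {orbit f x}))"
      using y 1[of y] 2[of y] 3[of y] by (cases "y \<in> orbit f x") (auto simp: orbits_def)
  next
    fix Q assume "Q \<in> insert {x} (insert (orbit f x - {x}) (orbits S f - {orbit f x}))"
    then consider "Q = {x}" | "Q = orbit f x - {x}" | y where "y \<in> S" "Q = orbit f y" "Q \<noteq> orbit f x"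
      by (auto simp: orbits_def)
    then show "Q \<in> orbits S (detach x f)"
    proof cases
      case 1
      then show ?thesis using orbit_detach_self[of x f] x by (auto simp: orbits_def)
    next
      case 2
      then have "Q = orbit (detach x f) (f x)" using 1[of "f x"] 3[OF 4(2)] x by simp
      then show ?thesis using 4 by (auto simp: orbits_def)
    next
      case 3
      then have "y \<notin> orbit f x" using orbit_eq_iff[OF f] by blast
      moreover have "x \<in> orbit f x" by (rule self_in_orbit[OF f])
      ultimately have "Q = orbit (detach x f) y" using 3 1[of y] 2[of y] by auto
      then show ?thesis using 3 by (auto simp: orbits_def)
    qed
  qed
qed

lemma orbits_detach_fresh:
  assumes f: "f permutes S" "finite S" and x: "x \<in> S" "f x \<noteq> x"
  shows "{x} \<notin> orbits S f" "orbit f x - {x} \<notin> orbits S f" "{x} \<noteq> orbit f x - {x}"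
    "orbit f x \<in> orbits S f" "f x \<in> orbit f x - {x}"
proof -
  have Q: "x \<in> orbit f x" "f x \<in> orbit f x" "orbit f x \<in> orbits S f"
    using self_in_orbit[OF f] x by (auto intro: orbit.base simp: orbits_def)
  show "orbit f x \<in> orbits S f" "f x \<in> orbit f x - {x}" using Q x by auto
  show "{x} \<notin> orbits S f"
    using orbits_disjoint[OF f Q(3), of "{x}" x] Q x(2) by auto
  show "orbit f x - {x} \<notin> orbits S f"
    using orbits_disjoint[OF f Q(3), of "orbit f x - {x}" "f x"] Q x(2) by auto
  show "{x} \<noteq> orbit f x - {x}" by auto
qed

lemma card_orbits_detach:
  assumes f: "f permutes S" "finite S" and x: "x \<in> S" "f x \<noteq> x"
  shows "card (orbits S (detach x f)) = card (orbits S f) + 1"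
proof -
  have "finite (orbits S f)" using f by (simp add: orbits_def)
  moreover have "card (orbits S f) > 0"
    using calculation x by (auto simp: orbits_def card_gt_0_iff)
  ultimately show ?thesis
    unfolding orbits_detach[OF assms] using orbits_detach_fresh[OF assms] by simp
qed

section \<open>Effect of a detachment on fixed points and 2-cycles avoiding 0\<close>

definition short_orbits :: "nat \<Rightarrow> nat \<Rightarrow> (nat \<Rightarrow> nat) \<Rightarrow> nat" where
  "short_orbits k n f = card {Q \<in> orbits {..n} f. card Q = k \<and> 0 \<notin> Q}"

lemma orbit_two:
  assumes f: "f permutes S" "finite S" and x: "f x \<noteq> x"
  shows "orbit f x = {x, f x} \<longleftrightarrow> f (f x) = x"
    and "x \<in> S \<Longrightarrow> card (orbit f x) = 2 \<Longrightarrow> f (f x) = x"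
    and "x \<in> S \<Longrightarrow> card (orbit f x) \<noteq> 1"
proof -
  have mem: "x \<in> orbit f x" "f x \<in> orbit f x" "f (f x) \<in> orbit f x"
    using self_in_orbit[OF f] by (auto intro: orbit.intros)
  have ne: "f (f x) \<noteq> f x"
    using x by (simp add: inj_eq[OF permutes_inj[OF f(1)]])
  have "y \<in> {x, f x}" if "f (f x) = x" "y \<in> orbit f x" for y
    using that(2) by induction (auto simp: that(1))
  with mem ne show "orbit f x = {x, f x} \<longleftrightarrow> f (f x) = x" by auto
  assume S: "x \<in> S"
  note fin = finite_orbit_permutes[OF f S]
  show "card (orbit f x) \<noteq> 1"
    using mem x by (auto simp: card_1_singleton_iff)
  show "f (f x) = x" if "card (orbit f x) = 2"
  proof -
    have "{x, f x} = orbit f x"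
      by (rule card_seteq[OF fin]) (use mem x that in auto)
    then show ?thesis using mem(3) ne by auto
  qed
qed

lemma finite_short_orbits: "finite {Q \<in> orbits {..n::nat} f. card Q = k \<and> 0 \<notin> Q}"
  by (simp add: orbits_def)

text \<open>\<open>not2\<close> excludes a 2-cycle avoiding 0. So the orbit that is split has size
  other than 1, and if its size is 2 it contains 0: no counted orbit is lost.\<close>

lemma short_orbits_detach:
  assumes f: "f permutes {..n}" and x: "x \<le> n" "f x \<noteq> x" "x \<noteq> 0"
    and not2: "\<not> (f x \<noteq> 0 \<and> f (f x) = x)"
  shows "short_orbits 1 n f + 1 \<le> short_orbits 1 n (detach x f)"
    and "short_orbits 2 n f \<le> short_orbits 2 n (detach x f)"
proof -
  let ?S = "\<lambda>k f. {Q \<in> orbits {..n} f. card Q = k \<and> 0 \<notin> Q}"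
  have x': "x \<in> {..n}" using x by simp
  note split = orbits_detach[OF f finite_atMost x' x(2)]
  note fresh = orbits_detach_fresh[OF f finite_atMost x' x(2)]
  note two = orbit_two[OF f finite_atMost x(2)]
  have "insert {x} (?S 1 f) \<subseteq> ?S 1 (detach x f)"
    unfolding split using two(3)[OF x'] x by auto
  from card_mono[OF finite_short_orbits this]
  show "short_orbits 1 n f + 1 \<le> short_orbits 1 n (detach x f)"
    using fresh(1) by (simp add: short_orbits_def finite_short_orbits)
  have "0 \<in> orbit f x" if "card (orbit f x) = 2"
    using two(1) two(2)[OF x' that] not2 by auto
  then have "?S 2 f \<subseteq> ?S 2 (detach x f)"
    unfolding split by auto
  from card_mono[OF finite_short_orbits this]
  show "short_orbits 2 n f \<le> short_orbits 2 n (detach x f)"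
    by (simp add: short_orbits_def)
qed

text \<open>Both elements of the 2-cycle become fixed, so a second new singleton offsets the lost
  2-cycle.\<close>

lemma short_orbits_detach_2_cycle:
  assumes f: "f permutes {..n}" and x: "x \<le> n" "f x \<noteq> x" "x \<noteq> 0"
    and 2: "f x \<noteq> 0" "f (f x) = x"
  shows "short_orbits 1 n f + 2 \<le> short_orbits 1 n (detach x f)"
    and "short_orbits 2 n f \<le> short_orbits 2 n (detach x f) + 1"
proof -
  let ?S = "\<lambda>k f. {Q \<in> orbits {..n} f. card Q = k \<and> 0 \<notin> Q}"
  have x': "x \<in> {..n}" using x by simp
  note split = orbits_detach[OF f finite_atMost x' x(2)]
  note fresh = orbits_detach_fresh[OF f finite_atMost x' x(2)]
  note two = orbit_two[OF f finite_atMost x(2)]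
  have orb: "orbit f x - {x} = {f x}" using two(1) 2 x by auto
  have "insert {x} (insert {f x} (?S 1 f)) \<subseteq> ?S 1 (detach x f)"
    unfolding split orb using two(3)[OF x'] x 2 by auto
  from card_mono[OF finite_short_orbits this]
  show "short_orbits 1 n f + 2 \<le> short_orbits 1 n (detach x f)"
    using fresh(1,2,3) x unfolding orb by (simp add: short_orbits_def finite_short_orbits)
  have "?S 2 f \<subseteq> insert (orbit f x) (?S 2 (detach x f))"
    unfolding split by auto
  then have "card (?S 2 f) \<le> card (insert (orbit f x) (?S 2 (detach x f)))"
    by (intro card_mono) (auto simp: orbits_def)
  also have "\<dots> \<le> card (?S 2 (detach x f)) + 1"
    by (simp add: card_insert_le_m1 card_insert_if finite_short_orbits)
  finally show "short_orbits 2 n f \<le> short_orbits 2 n (detach x f) + 1"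
    by (simp add: short_orbits_def)
qed

text \<open>Read backwards, this bounds the effect of merging the fixed point 0 into a cycle. By
  \<open>f (f 0) \<noteq> 0\<close> that cycle has at least two elements besides 0, so the merge
  destroys no counted fixed point and at most one counted 2-cycle.\<close>

lemma short_orbits_detach_0:
  assumes f: "f permutes {..n}" and x: "f 0 \<noteq> 0" "f (f 0) \<noteq> 0"
  shows "short_orbits 1 n (detach 0 f) \<le> short_orbits 1 n f"
    and "short_orbits 2 n (detach 0 f) \<le> short_orbits 2 n f + 1"
proof -
  let ?S = "\<lambda>k f. {Q \<in> orbits {..n} f. card Q = k \<and> 0 \<notin> Q}"
  have x': "0 \<in> {..n}" by simp
  note split = orbits_detach[OF f finite_atMost x' x(1)]
  have "f (f 0) \<noteq> f 0" using x by (simp add: inj_eq[OF permutes_inj[OF f]])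
  moreover have "f 0 \<in> orbit f 0 - {0}" "f (f 0) \<in> orbit f 0 - {0}"
    using x by (auto intro: orbit.intros)
  ultimately have "card (orbit f 0 - {0}) \<noteq> 1"
    by (metis card_1_singletonE singletonD)
  then have "?S 1 (detach 0 f) \<subseteq> ?S 1 f"
    unfolding split by auto
  from card_mono[OF finite_short_orbits this]
  show "short_orbits 1 n (detach 0 f) \<le> short_orbits 1 n f"
    by (simp add: short_orbits_def)
  have "?S 2 (detach 0 f) \<subseteq> insert (orbit f 0 - {0}) (?S 2 f)"
    unfolding split by auto
  then have "card (?S 2 (detach 0 f)) \<le> card (insert (orbit f 0 - {0}) (?S 2 f))"
    by (intro card_mono) (auto simp: orbits_def)
  also have "\<dots> \<le> card (?S 2 f) + 1"
    by (simp add: card_insert_if finite_short_orbits)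
  finally show "short_orbits 2 n (detach 0 f) \<le> short_orbits 2 n f + 1"
    by (simp add: short_orbits_def)
qed

section \<open>The potential\<close>

text \<open>\<open>n - 1\<close> stands where \<open>g_val\<close> has \<open>n + 1\<close>, because
  the number of 1-cycles plus \<open>f_val\<close> is \<open>short_orbits 1 n f + 1\<close>.\<close>

definition potential :: "nat \<Rightarrow> (nat \<Rightarrow> nat) \<Rightarrow> real" where
  "potential n f = (real n - 1 + real (card (orbits {..n} f))) / 2
     - real (short_orbits 1 n f) - of_int \<lceil>real (short_orbits 2 n f) / 2\<rceil>"

lemma half_ceiling_le:
  assumes "d \<le> d' + 2 * e"
  shows "of_int \<lceil>real d / 2\<rceil> \<le> (of_int \<lceil>real d' / 2\<rceil> :: real) + real e"
proof -
  have "real d / 2 \<le> real d' / 2 + real_of_int (int e)" using assms by simp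
  then have "\<lceil>real d / 2\<rceil> \<le> \<lceil>real d' / 2 + real_of_int (int e)\<rceil>" by (rule ceiling_mono)
  then show ?thesis unfolding ceiling_add_of_int by linarith
qed

text \<open>\<open>k\<close> is the rise of the first term, and \<open>e\<close> bounds the rise
  caused by losing at most \<open>2 * e\<close> orbits of size 2. The new fixed points pay for both
  and for the decrease by 1.\<close>

lemma potential_decreases:
  assumes "card (orbits {..n} g) = card (orbits {..n} f) + 2 * k"
    and m: "short_orbits 1 n f + k + 1 + e \<le> short_orbits 1 n g"
    and d: "short_orbits 2 n f \<le> short_orbits 2 n g + 2 * e"
  shows "potential n g \<le> potential n f - 1"
proof -
  have "real (short_orbits 1 n f) + real k + 1 + real e \<le> real (short_orbits 1 n g)"
    using m by linarith
  then show ?thesis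
    using assms(1) half_ceiling_le[OF d] unfolding potential_def by (simp add: add_divide_distrib)
qed

text \<open>As \<open>f B = 0\<close>, the first detachment is never from a 2-cycle avoiding 0 and
  gains a fixed point. The second gains another, or two at the price of one 2-cycle.\<close>

lemma potential_detach_twice:
  assumes f: "f permutes {..n}" and B: "B \<le> n" "B \<noteq> 0" "f B = 0"
    and E: "E \<le> n" "E \<noteq> 0" "detach B f E \<noteq> E"
  shows "potential n (detach E (detach B f)) \<le> potential n f - 1"
proof -
  let ?g = "detach B f"
  have g: "?g permutes {..n}" using f B by (simp add: detach_permutes)
  note B' = short_orbits_detach[OF f B(1) _ B(2)]
  have 1: "short_orbits 1 n f + 1 \<le> short_orbits 1 n ?g" "short_orbits 2 n f \<le> short_orbits 2 n ?g"
    using B' B by auto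
  have c: "card (orbits {..n} (detach E ?g)) = card (orbits {..n} f) + 2"
    using card_orbits_detach[OF f, of B] card_orbits_detach[OF g, of E] B E by simp
  show ?thesis
  proof (cases "?g E \<noteq> 0 \<and> ?g (?g E) = E")
    case True
    show ?thesis
      by (rule potential_decreases[where k = 1 and e = 1])
        (use short_orbits_detach_2_cycle[OF g E(1,3,2)] 1 c True in auto)
  next
    case False
    show ?thesis
      by (rule potential_decreases[where k = 1 and e = 0])
        (use short_orbits_detach[OF g E(1,3,2) False] 1 c in auto)
  qed
qed

text \<open>The composite detaches \<open>C\<close> and then merges 0 into the cycle of
  \<open>B\<close>, so the number of orbits is unchanged. If \<open>C\<close> comes from a 2-cycle,
  at most two 2-cycles are lost, and the two new fixed points pay for them; otherwise
  \<open>pref\<close> says that there are none to lose.\<close>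

lemma potential_fixed_0:
  assumes f: "f permutes {..n}" "f 0 = 0" and C: "C \<le> n" "f C = A" "A \<noteq> C"
    and B: "B \<le> n" "B \<noteq> 0" "B \<noteq> A" "B \<noteq> C" "f B \<noteq> B"
    and pref: "f A = C \<or> short_orbits 2 n f = 0"
  shows "potential n (transpose 0 B \<circ> transpose A C \<circ> f) \<le> potential n f - 1"
proof -
  let ?h = "detach C f" and ?g = "transpose 0 B \<circ> transpose A C \<circ> f"
  have inj: "inj f" using f permutes_inj by auto
  have h_eq: "?h = transpose A C \<circ> f"
    using C by (simp add: detach_def transpose_commute)
  have C0: "C \<noteq> 0" "A \<noteq> 0" using C f(2) inj_eq[OF inj, of C 0] by metis+
  have h: "?h permutes {..n}" using f C by (simp add: detach_permutes)
  have g_eq: "?g = transpose 0 B \<circ> ?h" unfolding h_eq by (simp add: comp_assoc)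
  have g: "?g permutes {..n}" unfolding g_eq
    using h B by (intro permutes_compose permutes_swap_id) auto
  have h0: "?h 0 = 0" using f C0 by (simp add: h_eq)
  have g0: "?g 0 = B" using h0 unfolding g_eq by simp
  \<comment> \<open>Merging 0 must not consume a fixed point; \<open>B \<noteq> A\<close> matters
    because detaching \<open>C\<close> from a 2-cycle leaves \<open>A\<close> fixed.\<close>
  have hB: "?h B \<noteq> B" using B C inj_eq[OF inj, of B C] by (auto simp: h_eq transpose_def)
  have "?g (?g 0) = transpose 0 B (?h B)"
    unfolding g0 by (simp add: h_eq)
  moreover have "transpose 0 B (?h B) \<noteq> 0" using hB B(2) by (auto simp: transpose_def)
  ultimately have gB: "?g (?g 0) \<noteq> 0" by (simp only: not_False_eq_True)
  \<comment> \<open>Detaching 0 undoes the merge, so \<open>short_orbits_detach_0\<close> compares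
    \<open>?g\<close> with \<open>?h\<close>.\<close>
  have detach_g: "detach 0 ?g = ?h"
    unfolding detach_def[of 0] g0 unfolding g_eq by (simp add: fun_eq_iff)
  have "?g 0 \<noteq> 0" using g0 B(2) by simp
  note 1 = short_orbits_detach_0[of ?g n, OF g this gB, unfolded detach_g]
  have c: "card (orbits {..n} ?g) = card (orbits {..n} f)"
    using card_orbits_detach[of f "{..n}" C, OF f(1)] card_orbits_detach[of ?g "{..n}" 0, OF g] C B
    unfolding g0 detach_g by simp
  show ?thesis
  proof (cases "f A = C")
    case True
    show ?thesis
      by (rule potential_decreases[where k = 0 and e = 1])
        (use short_orbits_detach_2_cycle[OF f(1) C(1) _ C0(1)] C C0 1 c True in auto)
  next
    case False
    show ?thesis
      by (rule potential_decreases[where k = 0 and e = 0])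
        (use short_orbits_detach[OF f(1) C(1) _ C0(1)] C C0 1 c pref False in auto)
  qed
qed

section \<open>Block-interchanges acting on positions\<close>

text \<open>\<open>s\<close>, \<open>x\<close> and \<open>y\<close> are the lengths of the first
  block, the gap and the second block. Piecewise shifts replace list indexing in the arithmetic
  below.\<close>

lemma block_interchange_eq:
  assumes "y > 0" "s + x + y \<le> n"
  shows "block_interchange n 1 (s + 1) (s + x + 1) (s + x + y + 1) p =
    (if p = 0 \<or> s + x + y < p then p
     else if p \<le> y then p + s + x
     else if p \<le> x + y then p - y + s
     else p - (x + y))"
proof -
  consider "p = 0 \<or> n < p" | t where "p = Suc (s + x + y + t)" "s + x + y + t < n" 
    | t where "p = Suc t" "t < y" "p \<le> n" | t where "p = Suc (y + t)" "t < x" "p \<le> n"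
    | t where "p = Suc (y + x + t)" "t < s" "p \<le> n"
  proof -
    consider "p = 0 \<or> n < p" | "s + x + y < p" "p \<le> n" | "0 < p" "p \<le> y" "p \<le> n"
       | "y < p" "p \<le> y + x" "p \<le> n" | "y + x < p" "p \<le> y + x + s" "p \<le> n"
      by linarith
    then show thesis
    proof cases
      case 2 then show thesis using that(2)[of "p - Suc (s + x + y)"] by simp
    next
      case 3 then show thesis using that(3)[of "p - 1"] by simp
    next
      case 4 then show thesis using that(4)[of "p - Suc y"] by simp
    next
      case 5 then show thesis using that(5)[of "p - Suc (y + x)"] by simp
    qed (use that in blast)
  qed
  then show ?thesis
  proof cases
    case 1 then show ?thesis using assms by (auto simp: block_interchange_def)
  next
    case 2 then show ?thesis by (simp add: block_interchange_def nth_append del: upt_Suc)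
  next
    case 3 then show ?thesis by (simp add: block_interchange_def nth_append del: upt_Suc)
  next
    case 4 then show ?thesis by (simp add: block_interchange_def nth_append del: upt_Suc)
  next
    case 5 then show ?thesis by (simp add: block_interchange_def nth_append del: upt_Suc)
  qed
qed
lemma block_interchange_permutes:
  assumes "s > 0" "y > 0" "s + x + y \<le> n"
  shows "block_interchange n 1 (s + 1) (s + x + 1) (s + x + y + 1) permutes {1..n}"
proof (rule inj_imp_permutes)
  let ?b = "block_interchange n 1 (s + 1) (s + x + 1) (s + x + y + 1)"
  \<comment> \<open>Exchanging the lengths \<open>s\<close> and \<open>y\<close> gives the
    inverse.\<close>
  let ?c = "block_interchange n 1 (y + 1) (y + x + 1) (y + x + s + 1)"
  have "?c (?b p) = p" for p
    using block_interchange_eq[OF assms(2,3)] block_interchange_eq[of s y x n] assms by auto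
  then show "inj_on ?b {1..n}"
    by (metis inj_on_inverseI)
  show "?b p = p" if "p \<notin> {1..n}" for p
    using that unfolding block_interchange_def by (rule if_not_P)
  show "?b p \<in> {1..n}" if "p \<in> {1..n}" for p
    using that block_interchange_eq[OF assms(2,3)] assms by auto
qed simp

text \<open>\<open>a\<close>, \<open>b\<close>, \<open>c\<close> are the last positions of the first
  block, the gap and the second block. Neighbours inside a block stay neighbours, so taking
  predecessors before or after the interchange differs only at the four cuts, where
  \<open>b\<close>, \<open>a\<close>, 0, \<open>c\<close> turn into 0, \<open>c\<close>,
  \<open>b\<close>, \<open>a\<close>.\<close>

lemma block_interchange_pred:
  assumes "0 < a" "a < b" "b < c" "c \<le> n" "p > 0"
  shows "block_interchange n 1 (a + 1) (b + 1) (c + 1) (p - 1) =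
    transpose 0 b (transpose a c (block_interchange n 1 (a + 1) (b + 1) (c + 1) p - 1))"
proof -
  obtain x y where xy: "b = a + x" "c = a + x + y" "x > 0" "y > 0"
    using assms by (metis add.assoc less_imp_add_positive)
  obtain q where q: "p = Suc q" using assms by (cases p) auto
  consider "q > c" | "q = c" | "0 < q" "q < y" | "q = 0" | "q = y" | "y < q" "q < x + y"
    | "q = x + y" | "x + y < q" "q < c"
    by linarith
  then show ?thesis
    using assms block_interchange_eq[of y a x n] unfolding xy q
    by cases (auto simp: transpose_def)
qed

text \<open>Without a gap there are three cuts, and the correction is the 3-cycle taking
  \<open>a\<close> to 0, 0 to \<open>c\<close> and \<open>c\<close> to \<open>a\<close>.\<close>

lemma block_interchange_pred_adjacent:
  assumes "0 < a" "a < c" "c \<le> n" "p > 0"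
  shows "block_interchange n 1 (a + 1) (a + 1) (c + 1) (p - 1) =
    transpose 0 a (transpose 0 c (block_interchange n 1 (a + 1) (a + 1) (c + 1) p - 1))"
proof -
  obtain y where y: "c = a + y" "y > 0"
    using assms by (metis less_imp_add_positive)
  obtain q where q: "p = Suc q" using assms by (cases p) auto
  consider "q > c" | "q = c" | "0 < q" "q < y" | "q = 0" | "q = y" | "y < q" "q < c"
    by linarith
  then show ?thesis
    using assms block_interchange_eq[of y a 0 n] unfolding y q
    by cases (auto simp: transpose_def)
qed
text \<open>In the breakpoint graph this is a black step followed by a grey step: the black edge at
  \<open>2 * u + 1\<close> leads to twice the value left of \<open>u + 1\<close>, and the grey edge
  to the odd vertex after it. The values 0 and \<open>n + 1\<close>, fixed by \<open>\<pi>\<close>,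
  are sentinels.\<close>

definition left_of_succ :: "(nat \<Rightarrow> nat) \<Rightarrow> nat \<Rightarrow> nat" where
  "left_of_succ \<pi> u = \<pi> (inv \<pi> (Suc u) - 1)"

text \<open>Makes the truncated subtraction in \<open>left_of_succ\<close> exact.\<close>

lemma inv_Suc_pos:
  assumes "\<pi> permutes {1..n::nat}"
  shows "inv \<pi> (Suc u) > 0"
  using permutes_inv_eq[OF assms, of "Suc u" 0] permutes_not_in[OF assms, of 0] by fastforce

lemma left_of_succ_eq_iff:
  assumes "\<pi> permutes {1..n}"
  shows "left_of_succ \<pi> u = \<pi> j \<longleftrightarrow> \<pi> (Suc j) = Suc u"
proof -
  have "left_of_succ \<pi> u = \<pi> j \<longleftrightarrow> inv \<pi> (Suc u) - 1 = j"
    unfolding left_of_succ_def by (simp add: inj_eq[OF permutes_inj[OF assms]])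
  also have "\<dots> \<longleftrightarrow> inv \<pi> (Suc u) = Suc j"
    using inv_Suc_pos[OF assms, of u] by auto
  also have "\<dots> \<longleftrightarrow> \<pi> (Suc j) = Suc u"
    using permutes_inv_eq[OF assms] by metis
  finally show ?thesis .
qed

lemma left_of_succ_permutes:
  assumes \<pi>: "\<pi> permutes {1..n}"
  shows "left_of_succ \<pi> permutes {..n}"
proof (rule inj_imp_permutes)
  show "inj_on (left_of_succ \<pi>) {..n}"
  proof (rule inj_onI)
    fix u v assume "left_of_succ \<pi> u = left_of_succ \<pi> v"
    then have "\<pi> (Suc (inv \<pi> (Suc u) - 1)) = Suc v"
      using left_of_succ_eq_iff[OF \<pi>, of v "inv \<pi> (Suc u) - 1"] by (simp add: left_of_succ_def)
    then show "u = v" using inv_Suc_pos[OF \<pi>, of u] permutes_inverses(1)[OF \<pi>] by simp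
  qed
  show "left_of_succ \<pi> u \<in> {..n}" if "u \<in> {..n}" for u
  proof -
    have "inv \<pi> (Suc u) - 1 \<le> n"
      using permutes_in_image[OF permutes_inv[OF \<pi>], of "Suc u"] that
        permutes_not_in[OF permutes_inv[OF \<pi>], of "Suc u"] by (cases "u = n") auto
    then show ?thesis
      using permutes_in_image[OF \<pi>, of "inv \<pi> (Suc u) - 1"]
        permutes_not_in[OF \<pi>, of "inv \<pi> (Suc u) - 1"]
      by (cases "inv \<pi> (Suc u) - 1 = 0") (auto simp: left_of_succ_def)
  qed
  show "left_of_succ \<pi> u = u" if "u \<notin> {..n}" for u
    using left_of_succ_eq_iff[OF \<pi>, of u u] permutes_not_in[OF \<pi>] that by simp
qed simp

text \<open>\<open>\<beta> p\<close> is the old position of \<open>u + 1\<close>, and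
  \<open>\<pi>\<close> conjugates a transposition of positions into the transposition of the values
  there.\<close>

lemma left_of_succ_comp:
  assumes \<pi>: "\<pi> permutes {1..n}" and \<beta>: "\<beta> permutes {1..n}"
    and eq: "\<And>p. p > 0 \<Longrightarrow> \<beta> (p - 1) = transpose w x (transpose y z (\<beta> p - 1))"
  shows "left_of_succ (\<pi> \<circ> \<beta>) =
    transpose (\<pi> w) (\<pi> x) \<circ> transpose (\<pi> y) (\<pi> z) \<circ> left_of_succ \<pi>"
proof
  fix u
  define p where "p = inv (\<pi> \<circ> \<beta>) (Suc u)"
  have p: "p > 0" unfolding p_def by (rule inv_Suc_pos[OF permutes_compose[OF \<beta> \<pi>]])
  have "\<pi> (\<beta> p) = Suc u"
    unfolding p_def using permutes_inverses(1)[OF permutes_compose[OF \<beta> \<pi>]] by simp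
  then have \<beta>p: "\<beta> p = inv \<pi> (Suc u)" using permutes_inverses(2)[OF \<pi>] by metis
  have tr: "\<pi> (transpose c d v) = transpose (\<pi> c) (\<pi> d) (\<pi> v)" for c d v
    by (simp add: transpose_def inj_eq[OF permutes_inj[OF \<pi>]])
  have "left_of_succ (\<pi> \<circ> \<beta>) u = \<pi> (\<beta> (p - 1))"
    by (simp add: left_of_succ_def p_def)
  also have "\<dots> = transpose (\<pi> w) (\<pi> x) (transpose (\<pi> y) (\<pi> z) (left_of_succ \<pi> u))"
    unfolding eq[OF p] \<beta>p tr by (simp add: left_of_succ_def)
  finally show "left_of_succ (\<pi> \<circ> \<beta>) u =
    (transpose (\<pi> w) (\<pi> x) \<circ> transpose (\<pi> y) (\<pi> z) \<circ> left_of_succ \<pi>) u" by simp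
qed

section \<open>Moves decreasing the potential\<close>

lemma exchange_move:
  assumes \<pi>: "\<pi> permutes {1..n}" and "0 < a" "a < b" "b < c" "c \<le> n"
  shows "\<exists>\<beta>\<in>prefix_block_interchanges n. \<beta> permutes {1..n} \<and>
    left_of_succ (\<pi> \<circ> \<beta>) = transpose 0 (\<pi> b) \<circ> transpose (\<pi> a) (\<pi> c) \<circ> left_of_succ \<pi>"
proof -
  let ?\<beta> = "block_interchange n 1 (a + 1) (b + 1) (c + 1)"
  have \<beta>: "?\<beta> permutes {1..n}"
    using block_interchange_permutes[of a "c - b" "b - a" n] assms by simp
  moreover have "?\<beta> \<in> prefix_block_interchanges n"
    using assms unfolding prefix_block_interchanges_def by fastforce
  moreover have "\<pi> 0 = 0" using permutes_not_in[OF \<pi>] by simp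
  ultimately show ?thesis
    using left_of_succ_comp[OF \<pi> \<beta> block_interchange_pred[OF assms(2-)]] by auto
qed

lemma rotate_move:
  assumes \<pi>: "\<pi> permutes {1..n}" and "0 < a" "a < c" "c \<le> n"
  shows "\<exists>\<beta>\<in>prefix_block_interchanges n. \<beta> permutes {1..n} \<and>
    left_of_succ (\<pi> \<circ> \<beta>) = transpose 0 (\<pi> a) \<circ> transpose 0 (\<pi> c) \<circ> left_of_succ \<pi>"
proof -
  let ?\<beta> = "block_interchange n 1 (a + 1) (a + 1) (c + 1)"
  have \<beta>: "?\<beta> permutes {1..n}"
    using block_interchange_permutes[of a "c - a" 0 n] assms by simp
  moreover have "?\<beta> \<in> prefix_block_interchanges n"
    using assms unfolding prefix_block_interchanges_def by fastforce
  moreover have "\<pi> 0 = 0" using permutes_not_in[OF \<pi>] by simp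
  ultimately show ?thesis
    using left_of_succ_comp[OF \<pi> \<beta> block_interchange_pred_adjacent[OF assms(2-)]] by auto
qed

text \<open>If \<open>left_of_succ \<pi>\<close> mapped the values at the positions strictly between \<open>a\<close> and \<open>c\<close> among
  themselves, then summing \<open>left_of_succ \<pi> (\<pi> i) = \<pi> j \<longleftrightarrow> \<pi> (j + 1) = \<pi> i + 1\<close> over these positions
  would telescope to \<open>\<pi> c \<ge> \<pi> (a + 1)\<close>.\<close>

lemma leaves_interval:
  assumes \<pi>: "\<pi> permutes {1..n}" and "a < c" and desc: "\<pi> (Suc a) = Suc (\<pi> c)"
  obtains i j where "a < i" "i < c" "left_of_succ \<pi> (\<pi> i) = \<pi> j" "j \<le> a \<or> c \<le> j"
proof (rule ccontr)
  assume no: "\<not> thesis"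
  define s where "s i = inv \<pi> (Suc (\<pi> i)) - 1" for i
  have \<pi>s: "left_of_succ \<pi> (\<pi> i) = \<pi> (s i)" for i
    by (simp add: s_def left_of_succ_def)
  let ?A = "{Suc a..<c}"
  have "s ` ?A \<subseteq> ?A"
  proof (rule image_subsetI)
    fix i assume "i \<in> ?A"
    then have "a < i" "i < c" by auto
    with no that[OF _ _ \<pi>s] have "\<not> (s i \<le> a \<or> c \<le> s i)" by blast
    then show "s i \<in> ?A" by auto
  qed
  moreover have "inj_on s ?A"
  proof (rule inj_onI)
    fix i j assume "s i = s j"
    then have "\<pi> i = \<pi> j"
      using \<pi>s permutes_inj[OF left_of_succ_permutes[OF \<pi>]] by (metis injD)
    then show "i = j" by (simp add: inj_eq[OF permutes_inj[OF \<pi>]])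
  qed
  ultimately have bij: "bij_betw s ?A ?A" by (simp add: bij_betw_def endo_inj_surj)
  have "\<pi> (Suc (s i)) = Suc (\<pi> i)" for i
    using left_of_succ_eq_iff[OF \<pi>] \<pi>s by simp
  then have "(\<Sum>i\<in>?A. \<pi> (Suc i)) = (\<Sum>i\<in>?A. Suc (\<pi> i))"
    using sum.reindex_bij_betw[OF bij, of "\<lambda>i. \<pi> (Suc i)"] by simp
  also have "\<dots> = (\<Sum>i\<in>?A. \<pi> i) + card ?A" by (simp add: sum_Suc)
  finally have "(\<Sum>i\<in>?A. \<pi> (Suc i)) + \<pi> (Suc a) = (\<Sum>i\<in>?A. \<pi> i) + card ?A + \<pi> (Suc a)" by simp
  \<comment> \<open>The extra term completes the shifted sum to the sum from \<open>Suc a\<close> to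
    \<open>c\<close>. Cancelling gives \<open>\<pi> c = \<pi> (Suc a) + card ?A\<close>, against
    \<open>desc\<close>.\<close>
  moreover have "(\<Sum>i\<in>?A. \<pi> (Suc i)) + \<pi> (Suc a) = (\<Sum>i\<in>{Suc a..<Suc c}. \<pi> i)"
    using sum.atLeast_Suc_lessThan[of "Suc a" "Suc c" \<pi>] \<open>a < c\<close>
    by (simp add: sum.shift_bounds_Suc_ivl del: sum.op_ivl_Suc)
  moreover have "\<dots> = (\<Sum>i\<in>?A. \<pi> i) + \<pi> c" using \<open>a < c\<close> by simp
  ultimately show False using desc by simp
qed


text \<open>\<open>v\<close> is a point where \<open>g\<close> is largest on the orbit. With
  \<open>g\<close> the position of a value, this yields a jump to the left in every nontrivial
  cycle.\<close>

lemma descent_in_orbit: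
  assumes f: "f permutes S" "finite S" and u: "u \<in> S" "f u \<noteq> u" and g: "inj (g :: nat \<Rightarrow> nat)"
  obtains v where "v \<in> orbit f u" "f v \<noteq> v" "g (f v) < g v"
proof -
  have u_in: "u \<in> orbit f u" by (rule self_in_orbit[OF f])
  have fin: "finite (g ` orbit f u)" using finite_orbit_permutes[OF f u(1)] by simp
  have "Max (g ` orbit f u) \<in> g ` orbit f u" using Max_in[OF fin] u_in by blast
  then obtain v where v: "v \<in> orbit f u" "Max (g ` orbit f u) = g v" by blast
  have "f v \<in> orbit f u" using v(1) by (rule orbit.step)
  then have "g (f v) \<le> g v" using Max_ge[OF fin] v(2) by force
  moreover have "f v \<noteq> v"
    using v(1) u u_in orbit_eq_iff[OF f, of v u] orbit_eq_singleton_iff[of f v] by auto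
  ultimately show thesis using that[OF v(1)] g by (metis inj_eq le_neq_implies_less)
qed

lemma left_of_succ_0_iff:
  assumes "\<pi> permutes {1..n}"
  shows "left_of_succ \<pi> 0 = 0 \<longleftrightarrow> \<pi> 1 = 1"
  using left_of_succ_eq_iff[OF assms, of 0 0] permutes_not_in[OF assms, of 0] by simp

lemma ex_decreasing_move:
  assumes \<pi>: "\<pi> permutes {1..n}" "\<pi> \<noteq> id"
  shows "\<exists>\<beta>\<in>prefix_block_interchanges n. \<beta> permutes {1..n} \<and>
    potential n (left_of_succ (\<pi> \<circ> \<beta>)) \<le> potential n (left_of_succ \<pi>) - 1"
proof -
  let ?f = "left_of_succ \<pi>" and ?pos = "inv \<pi>"
  note f = left_of_succ_permutes[OF \<pi>(1)] and edge = left_of_succ_eq_iff[OF \<pi>(1)]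
  have inj: "\<pi> x = \<pi> y \<longleftrightarrow> x = y" and f_inj: "?f x = ?f y \<longleftrightarrow> x = y" for x y
    using permutes_inj[OF \<pi>(1)] permutes_inj[OF f] by (auto simp: inj_eq)
  have \<pi>0: "\<pi> 0 = 0" using permutes_not_in[OF \<pi>(1)] by simp
  have le: "\<pi> x \<le> n \<longleftrightarrow> x \<le> n" for x
    using permutes_in_image[OF \<pi>(1), of x] permutes_not_in[OF \<pi>(1), of x] \<pi>0
    by (cases "x = 0"; cases "x \<le> n") auto
  have f_le: "?f x \<le> n \<longleftrightarrow> x \<le> n" for x
    using permutes_in_image[OF f, of x] by simp
  have \<pi>_pos: "\<pi> (?pos x) = x" for x by (rule permutes_inverses(1)[OF \<pi>(1)])
  show ?thesis
  proof (cases "\<pi> 1 = 1")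
    case False
    have "\<pi> 1 \<noteq> 0" using inj[of 1 0] \<pi>0 by simp
    \<comment> \<open>\<open>\<pi> b\<close> is the predecessor of 0 in its cycle, and the positions
      0 and \<open>b\<close> fit the hypothesis of \<open>leaves_interval\<close>.\<close>
    define b where "b = ?pos (\<pi> 1 - 1)"
    have "\<pi> (Suc 0) = Suc (\<pi> b)" using \<open>\<pi> 1 \<noteq> 0\<close> by (simp add: b_def \<pi>_pos)
    then have fB: "?f (\<pi> b) = 0" using edge[of "\<pi> b" 0] \<pi>0 by simp
    then have "b \<le> n" using f_le[of "\<pi> b"] le by simp
    have "b \<noteq> 0" using False \<open>\<pi> (Suc 0) = Suc (\<pi> b)\<close> \<pi>0 by (cases "b = 0") auto
    then obtain e c where e: "0 < e" "e < b" "?f (\<pi> e) = \<pi> c" "c \<le> 0 \<or> b \<le> c"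
      using leaves_interval[OF \<pi>(1) _ \<open>\<pi> (Suc 0) = Suc (\<pi> b)\<close>] by blast
    \<comment> \<open>Only \<open>\<pi> b\<close> is mapped to 0, so the image of
      \<open>\<pi> e\<close> sits at \<open>b\<close> or to its right.\<close>
    have "c \<noteq> 0"
    proof
      assume "c = 0"
      then have "?f (\<pi> e) = ?f (\<pi> b)" using e(3) fB \<pi>0 by simp
      then show False using f_inj inj e(2) by simp
    qed
    then have "b \<le> c" using e by simp
    have "c \<le> n" using f_le[of "\<pi> e"] e \<open>b \<le> n\<close> by (simp add: le)
    have ne: "\<pi> b \<noteq> 0" "\<pi> e \<noteq> 0" "\<pi> c \<noteq> 0" "\<pi> e \<noteq> \<pi> b"
      using inj[of _ 0] inj[of e b] e \<open>b \<noteq> 0\<close> \<open>c \<noteq> 0\<close> \<pi>0 by auto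
    have d: "detach (\<pi> b) ?f = transpose 0 (\<pi> b) \<circ> ?f"
      by (simp add: detach_def fB transpose_commute)
    \<comment> \<open>What pointed at \<open>\<pi> b\<close> now points at 0. If
      \<open>c = b\<close> this concerns \<open>\<pi> e\<close>, and the blocks ending at
      \<open>e\<close> and \<open>b\<close> are exchanged as neighbours.\<close>
    have dE: "detach (\<pi> b) ?f (\<pi> e) = (if c = b then 0 else \<pi> c)"
      unfolding d using e(3) ne inj by simp
    have pot: "potential n (detach (\<pi> e) (detach (\<pi> b) ?f)) \<le> potential n ?f - 1"
      by (rule potential_detach_twice[OF f]) (use le \<open>b \<le> n\<close> e fB ne dE inj \<open>b \<le> c\<close> in auto)
    show ?thesis
    proof (cases "c = b")
      case True
      then have "detach (\<pi> e) (detach (\<pi> b) ?f) = transpose 0 (\<pi> e) \<circ> transpose 0 (\<pi> b) \<circ> ?f"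
        unfolding detach_def[of "\<pi> e"] dE unfolding d by (simp add: comp_assoc transpose_commute)
      then show ?thesis
        using rotate_move[OF \<pi>(1) e(1,2) \<open>b \<le> n\<close>] pot by fastforce
    next
      case neq: False
      have "detach (\<pi> e) (detach (\<pi> b) ?f) = transpose (\<pi> e) (\<pi> c) \<circ> (transpose 0 (\<pi> b) \<circ> ?f)"
        unfolding detach_def[of "\<pi> e"] dE unfolding d using neq by simp
      also have "\<dots> = transpose 0 (\<pi> b) \<circ> transpose (\<pi> e) (\<pi> c) \<circ> ?f"
        using ne neq inj by (auto simp: fun_eq_iff transpose_def)
      finally show ?thesis
        using exchange_move[OF \<pi>(1) e(1,2) _ \<open>c \<le> n\<close>] pot \<open>b \<le> c\<close> neq by fastforce
    qed
  next
    case True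
    then have f0: "?f 0 = 0" using left_of_succ_0_iff[OF \<pi>(1)] by simp
    have "\<exists>u\<le>n. ?f u \<noteq> u"
    proof (rule ccontr)
      assume "\<not> ?thesis"
      then have *: "\<pi> (Suc i) = Suc (\<pi> i)" for i
        using edge[of "\<pi> i" i] permutes_not_in[OF f, of "\<pi> i"] by (cases "\<pi> i \<le> n") auto
      have "\<pi> i = i" for i by (induction i) (use * \<pi>0 in auto)
      with \<pi>(2) show False by auto
    qed
    \<comment> \<open>A 2-cycle is chosen whenever there is one, so that \<open>pref\<close> in
      \<open>potential_fixed_0\<close> holds.\<close>
    moreover have "\<exists>u\<le>n. ?f u \<noteq> u \<and> ?f (?f u) = u" if "short_orbits 2 n ?f \<noteq> 0"
    proof -
      from that obtain u where u: "u \<le> n" "card (orbit ?f u) = 2"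
        unfolding short_orbits_def orbits_def by (auto simp: card_eq_0_iff)
      have "?f u \<noteq> u" using u(2) orbit_eq_singleton_iff[of ?f u] by auto
      then show ?thesis using orbit_two(2)[OF f finite_atMost] u by auto
    qed
    ultimately obtain u where u: "u \<le> n" "?f u \<noteq> u" "?f (?f u) = u \<or> short_orbits 2 n ?f = 0"
      by blast
    \<comment> \<open>A jump to the left puts the position \<open>a\<close> of the image before the
      position \<open>c\<close> of \<open>C\<close>.\<close>
    obtain C where C: "C \<in> orbit ?f u" "?f C \<noteq> C" "?pos (?f C) < ?pos C"
      using descent_in_orbit[OF f finite_atMost _ u(2) permutes_inj[OF permutes_inv[OF \<pi>(1)]]] u(1)
      by auto
    have "C \<le> n" using permutes_orbit_subset[OF f, of u] C(1) u(1) by auto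
    have pref: "?f (?f C) = C \<or> short_orbits 2 n ?f = 0"
    proof -
      have "C \<in> {u, ?f u}" if "?f (?f u) = u"
        using orbit_two(1)[OF f finite_atMost u(2)] that C(1) by auto
      then show ?thesis using u(3) by auto
    qed
    define a c where "a = ?pos (?f C)" and "c = ?pos C"
    have ac: "\<pi> a = ?f C" "\<pi> c = C" "a < c" using C(3) \<pi>_pos by (auto simp: a_def c_def)
    have "c \<le> n" using le[of c] ac \<open>C \<le> n\<close> by simp
    \<comment> \<open>The first block is to end at \<open>a\<close>; with \<open>a = 0\<close>, both
      0 and \<open>C\<close> would be mapped to 0.\<close>
    have "a \<noteq> 0" using ac(1) f0 f_inj C(2) \<pi>0 by metis
    have "\<pi> (Suc a) = Suc (\<pi> c)" using edge[of C a] ac by simp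
    \<comment> \<open>An element strictly between \<open>a\<close> and \<open>c\<close> whose image
      is not is not fixed, so it can play the role of \<open>B\<close>.\<close>
    then obtain b j where b: "a < b" "b < c" "?f (\<pi> b) = \<pi> j" "j \<le> a \<or> c \<le> j"
      using leaves_interval[OF \<pi>(1) ac(3)] by blast
    have "potential n (transpose 0 (\<pi> b) \<circ> transpose (\<pi> a) (\<pi> c) \<circ> ?f) \<le> potential n ?f - 1"
    proof (rule potential_fixed_0[OF f f0])
      show "\<pi> c \<le> n" "?f (\<pi> c) = \<pi> a" "\<pi> a \<noteq> \<pi> c" using ac le \<open>c \<le> n\<close> C(2) by auto
      show "\<pi> b \<le> n" "\<pi> b \<noteq> 0" "\<pi> b \<noteq> \<pi> a" "\<pi> b \<noteq> \<pi> c" "?f (\<pi> b) \<noteq> \<pi> b"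
        using b \<open>c \<le> n\<close> inj[of b 0] \<pi>0 by (auto simp: le inj)
      show "?f (\<pi> a) = \<pi> c \<or> short_orbits 2 n ?f = 0" using pref ac by simp
    qed
    then show ?thesis
      using exchange_move[OF \<pi>(1) _ b(1,2) \<open>c \<le> n\<close>] \<open>a \<noteq> 0\<close> by fastforce
  qed
qed

section \<open>Induction on the potential\<close>

lemma pbid_comp_le:
  assumes \<pi>: "\<pi> permutes {1..n}" and \<beta>: "\<beta> permutes {1..n}" "\<beta> \<in> prefix_block_interchanges n"
  shows "pbid n \<pi> \<le> pbid n (\<pi> \<circ> \<beta>) + 1"
proof -
  obtain \<beta>s where \<beta>s: "length \<beta>s = pbid n (\<pi> \<circ> \<beta>)" "pbi_sorts n (\<pi> \<circ> \<beta>) \<beta>s"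
    using pbid_attained[OF permutes_compose[OF \<beta>(1) \<pi>]] by blast
  have "pbi_sorts n \<pi> (\<beta> # \<beta>s)" using \<beta>s(2) \<beta>(2) by (simp add: pbi_sorts_def)
  then show ?thesis
    unfolding pbid_def[of n \<pi>] using \<beta>s(1) by (intro Least_le exI[of _ "\<beta> # \<beta>s"]) simp
qed

lemma pbid_id: "pbid n id = 0"
  unfolding pbid_def by (rule Least_eq_0) (simp add: pbi_sorts_def)

lemma orbits_id: "orbits S id = (\<lambda>x. {x}) ` S"
  unfolding orbits_def by (intro image_cong refl) (simp add: orbit_eq_singleton_iff)

lemma potential_id: "potential n id = 0"
proof -
  have "card (orbits {..n} id) = n + 1"
    by (simp add: orbits_id card_image)
  moreover have "{Q \<in> orbits {..n} id. card Q = 1 \<and> 0 \<notin> Q} = (\<lambda>x. {x}) ` {1..n}"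
    by (auto simp: orbits_id)
  then have "short_orbits 1 n id = n"
    by (simp add: short_orbits_def card_image)
  moreover have "{Q \<in> orbits {..n} id. card Q = 2 \<and> 0 \<notin> Q} = {}"
    by (auto simp: orbits_id)
  then have "short_orbits 2 n id = 0"
    by (simp only: short_orbits_def card.empty)
  ultimately show ?thesis by (simp add: potential_def)
qed

lemma card_orbits_le: "card {Q \<in> orbits {..n} f. P Q} \<le> n + 1"
proof -
  have "card {Q \<in> orbits {..n} f. P Q} \<le> card (orbits {..n} f)"
    by (intro card_mono) (auto simp: orbits_def)
  also have "\<dots> \<le> card {..n}" unfolding orbits_def by (rule card_image_le) simp
  finally show ?thesis by simp
qed

lemma potential_lower_bound: "potential n f \<ge> - 2 * real n - 4"
proof -
  have "short_orbits 1 n f \<le> n + 1" "short_orbits 2 n f \<le> n + 1"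
    unfolding short_orbits_def by (rule card_orbits_le)+
  moreover have "real_of_int \<lceil>real (short_orbits 2 n f) / 2\<rceil> \<le> real (short_orbits 2 n f) / 2 + 1"
    by linarith
  ultimately show ?thesis unfolding potential_def by (simp add: field_simps)
qed

text \<open>By \<open>potential_lower_bound\<close>, the shift by \<open>2 * real n + 5\<close>
  keeps the measure at least 1 after a move, so a decrease by at least 1 strictly lowers its floor
  as a natural number.\<close>

lemma pbid_le_potential:
  assumes "\<pi> permutes {1..n}"
  shows "real (pbid n \<pi>) \<le> potential n (left_of_succ \<pi>)"
  using assms
proof (induction "nat \<lfloor>potential n (left_of_succ \<pi>) + 2 * real n + 5\<rfloor>" arbitrary: \<pi> rule: less_induct)
  case less
  show ?case
  proof (cases "\<pi> = id")
    case True
    have "left_of_succ \<pi> = id" by (auto simp: left_of_succ_def True)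
    then show ?thesis by (simp add: True pbid_id potential_id)
  next
    case False
    then obtain \<beta> where \<beta>: "\<beta> \<in> prefix_block_interchanges n" "\<beta> permutes {1..n}"
        and dec: "potential n (left_of_succ (\<pi> \<circ> \<beta>)) \<le> potential n (left_of_succ \<pi>) - 1"
      using ex_decreasing_move[OF less.prems] by blast
    have "potential n (left_of_succ (\<pi> \<circ> \<beta>)) \<ge> - 2 * real n - 4"
      by (rule potential_lower_bound)
    then have "real (pbid n (\<pi> \<circ> \<beta>)) \<le> potential n (left_of_succ (\<pi> \<circ> \<beta>))"
      using dec by (intro less.hyps permutes_compose[OF \<beta>(2) less.prems]) linarith
    then show ?thesis using pbid_comp_le[OF less.prems \<beta>(2,1)] dec by linarith
  qed
qed


section \<open>The cycles of the breakpoint graph as orbits\<close>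

text \<open>The edge at position \<open>i\<close> gets the label \<open>u\<close> with
  \<open>\<pi> (i + 1) = u + 1\<close>, so its ends are \<open>2 * \<pi> i\<close> and
  \<open>2 * (u + 1) - 1\<close>. For \<open>i = n\<close> the sentinel gives
  \<open>u = n\<close>.\<close>

lemma black_edges_eq:
  assumes \<pi>: "\<pi> permutes {1..n}"
  shows "black_edges n \<pi> = {{2 * left_of_succ \<pi> u, 2 * u + 1} | u. u \<le> n}"
proof -
  let ?f = "left_of_succ \<pi>"
  note f = left_of_succ_permutes[OF \<pi>] and edge = left_of_succ_eq_iff[OF \<pi>]
  have \<pi>0: "\<pi> 0 = 0" using permutes_not_in[OF \<pi>] by simp
  have le: "\<pi> x \<le> n \<longleftrightarrow> x \<le> n" for x
    using permutes_in_image[OF \<pi>, of x] permutes_not_in[OF \<pi>, of x] \<pi>0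
    by (cases "x = 0"; cases "x \<le> n") auto
  have d: "{doubled n \<pi> (2 * i), doubled n \<pi> (2 * i + 1)} = {2 * ?f u, 2 * u + 1}"
    if "i \<le> n" "?f u = \<pi> i" for i u
  proof -
    have "Suc u = \<pi> (Suc i)" using edge[of u i] that(2) by simp
    moreover have "\<pi> (Suc n) = Suc n" using permutes_not_in[OF \<pi>] by simp
    ultimately have "doubled n \<pi> (2 * i + 1) = 2 * u + 1"
      using that(1) by (cases "i = n") (auto simp: doubled_def)
    moreover have "doubled n \<pi> (2 * i) = 2 * ?f u"
      using that \<pi>0 by (auto simp: doubled_def)
    ultimately show ?thesis by simp
  qed
  show ?thesis
  proof (intro equalityI subsetI)
    fix e assume "e \<in> black_edges n \<pi>"
    then obtain i where i: "i \<le> n" "e = {doubled n \<pi> (2 * i), doubled n \<pi> (2 * i + 1)}"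
      by (auto simp: black_edges_def)
    have "?f (inv ?f (\<pi> i)) = \<pi> i" by (rule permutes_inverses(1)[OF f])
    moreover from this have "inv ?f (\<pi> i) \<le> n"
      using permutes_in_image[OF f, of "inv ?f (\<pi> i)"] i le[of i] by simp
    ultimately show "e \<in> {{2 * ?f u, 2 * u + 1} | u. u \<le> n}" using i d by blast
  next
    fix e assume "e \<in> {{2 * ?f u, 2 * u + 1} | u. u \<le> n}"
    then obtain u where u: "u \<le> n" "e = {2 * ?f u, 2 * u + 1}" by blast
    have "\<pi> (inv \<pi> (?f u)) = ?f u" by (rule permutes_inverses(1)[OF \<pi>])
    moreover from this have "inv \<pi> (?f u) \<le> n"
      using permutes_in_image[OF f, of u] u le[of "inv \<pi> (?f u)"] by simp
    ultimately show "e \<in> black_edges n \<pi>"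
      using u d[of "inv \<pi> (?f u)" u] unfolding black_edges_def by auto
  qed
qed

text \<open>Each label \<open>u\<close> contributes both edges at the vertex
  \<open>2 * u + 1\<close>.\<close>

definition orbit_cycle :: "(nat \<Rightarrow> nat) \<Rightarrow> nat set \<Rightarrow> nat set set \<times> nat set set" where
  "orbit_cycle f Q = ((\<lambda>u. {2 * f u, 2 * u + 1}) ` Q, (\<lambda>u. {2 * u, 2 * u + 1}) ` Q)"

lemma even_odd_pair_eq_iff:
  "{2 * a, 2 * b + 1} = {2 * c, 2 * d + 1} \<longleftrightarrow> a = c \<and> b = (d :: nat)"
  by (auto simp: doubleton_eq_iff) presburger+

text \<open>Each colour alone meets every vertex, so \<open>alternating_list_orbit\<close> can find
  an edge of either colour at any vertex.\<close>

lemma Union_black_part: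
  assumes "even (length vs)"
  shows "\<Union> (black_part vs) = set vs"
proof (intro equalityI subsetI)
  fix x assume "x \<in> \<Union> (black_part vs)"
  then obtain i where "2 * i < length vs" "x = vs ! (2 * i) \<or> x = vs ! (2 * i + 1)"
    by (auto simp: black_part_def)
  moreover from this(1) assms have "2 * i + 1 < length vs" by presburger
  ultimately show "x \<in> set vs" by auto
next
  fix x assume "x \<in> set vs"
  then obtain j where j: "j < length vs" "x = vs ! j" by (auto simp: in_set_conv_nth)
  have "x \<in> {vs ! (2 * (j div 2)), vs ! (2 * (j div 2) + 1)}"
    using j by (cases "even j") auto
  moreover have "2 * (j div 2) < length vs" using j by simp
  ultimately show "x \<in> \<Union> (black_part vs)" unfolding black_part_def by blast
qed

lemma Union_grey_part:
  assumes "even (length vs)"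
  shows "\<Union> (grey_part vs) = set vs"
proof (intro equalityI subsetI)
  fix x assume "x \<in> \<Union> (grey_part vs)"
  then obtain i where "2 * i < length vs" "x = vs ! (2 * i + 1) \<or> x = vs ! ((2 * i + 2) mod length vs)"
    by (auto simp: grey_part_def)
  moreover from this(1) assms have "2 * i + 1 < length vs" by presburger
  moreover from this have "(2 * i + 2) mod length vs < length vs" by (intro mod_less_divisor) linarith
  ultimately show "x \<in> set vs" by auto
next
  fix x assume "x \<in> set vs"
  then obtain j where j: "j < length vs" "x = vs ! j" by (auto simp: in_set_conv_nth)
  have "\<exists>i. 2 * i < length vs \<and> (j = 2 * i + 1 \<or> j = (2 * i + 2) mod length vs)"
  proof (cases "even j")
    case True
    show ?thesis
    proof (cases "j = 0")
      case True
      \<comment> \<open>The first vertex is an end of the last grey edge, by the reduction modulo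
        the length.\<close>
      obtain m where m: "length vs = 2 * m" using assms by blast
      then obtain k where "m = Suc k" using j by (cases m) auto
      then show ?thesis using True m by (intro exI[of _ k]) simp
    next
      case False
      with \<open>even j\<close> obtain i where "j = 2 * i + 2" by atomize_elim presburger
      then show ?thesis using j by (intro exI[of _ i]) simp
    qed
  next
    case False
    then obtain i where "j = 2 * i + 1" by (blast elim: oddE)
    then show ?thesis using j by (intro exI[of _ i]) simp
  qed
  then obtain i where "2 * i < length vs" "x \<in> {vs ! (2 * i + 1), vs ! ((2 * i + 2) mod length vs)}"
    using j by blast
  then show "x \<in> \<Union> (grey_part vs)" unfolding grey_part_def by blast
qed

text \<open>Grey edges pair \<open>2 * u\<close> with \<open>2 * u + 1\<close>, so a traversal is
  described by its set \<open>Q\<close> of labels. Covering by both colours shows that its edges are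
  those of \<open>Q\<close> and that \<open>Q\<close> is closed under \<open>f\<close>; walking
  along the list shows that \<open>Q\<close> stays in one orbit.\<close>

lemma alternating_list_orbit:
  assumes f: "f permutes {..n}" and vs: "vs \<noteq> []" "even (length vs)"
    and black: "black_part vs \<subseteq> {{2 * f u, 2 * u + 1} | u. u \<le> n}"
    and grey: "grey_part vs \<subseteq> grey_edges n"
  shows "(black_part vs, grey_part vs) \<in> orbit_cycle f ` orbits {..n} f"
proof -
  define Q where "Q = {u. 2 * u + 1 \<in> set vs}"
  note UB = Union_black_part[OF vs(2)] and UG = Union_grey_part[OF vs(2)]
  have grey_at: "{2 * (w div 2), 2 * (w div 2) + 1} \<in> grey_part vs \<and> w div 2 \<le> n"
    if w: "w \<in> set vs" for w
  proof -
    obtain e where e: "e \<in> grey_part vs" "w \<in> e" using w UG by blast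
    then obtain u where "u \<le> n" "e = {2 * u, 2 * u + 1}" using grey unfolding grey_edges_def by blast
    moreover from this e have "w div 2 = u" by auto
    ultimately show ?thesis using e by simp
  qed
  have Q_div: "w div 2 \<in> Q" if "w \<in> set vs" for w
    using grey_at[OF that] UG unfolding Q_def by blast
  have Q_le: "u \<le> n" if "u \<in> Q" for u
    using grey_at[of "2 * u + 1"] that by (simp add: Q_def)
  have grey_image: "grey_part vs = (\<lambda>u. {2 * u, 2 * u + 1}) ` Q"
  proof (intro equalityI subsetI)
    fix e assume e: "e \<in> grey_part vs"
    then obtain u where "e = {2 * u, 2 * u + 1}" using grey unfolding grey_edges_def by blast
    moreover from this e UG have "u \<in> Q" unfolding Q_def by blast
    ultimately show "e \<in> (\<lambda>u. {2 * u, 2 * u + 1}) ` Q" by blast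
  next
    fix e assume "e \<in> (\<lambda>u. {2 * u, 2 * u + 1}) ` Q"
    then show "e \<in> grey_part vs" using grey_at[of "2 * _ + 1"] by (auto simp: Q_def)
  qed
  have black_at: "{2 * f u, 2 * u + 1} \<in> black_part vs" if u: "u \<in> Q" for u
  proof -
    obtain e where e: "e \<in> black_part vs" "2 * u + 1 \<in> e" using u UB unfolding Q_def by blast
    then obtain u' where "e = {2 * f u', 2 * u' + 1}" using black by blast
    moreover from this e(2) have "u' = u" by simp presburger
    ultimately show ?thesis using e by simp
  qed
  have black_image: "black_part vs = (\<lambda>u. {2 * f u, 2 * u + 1}) ` Q"
  proof (intro equalityI subsetI)
    fix e assume e: "e \<in> black_part vs"
    then obtain u where "e = {2 * f u, 2 * u + 1}" using black by blast
    moreover from this e UB have "u \<in> Q" unfolding Q_def by blast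
    ultimately show "e \<in> (\<lambda>u. {2 * f u, 2 * u + 1}) ` Q" by blast
  qed (use black_at in auto)
  define u0 where "u0 = vs ! 0 div 2"
  have u0: "u0 \<in> Q" unfolding u0_def using vs(1) by (intro Q_div) simp
  have closed: "f u \<in> Q" if "u \<in> Q" for u
  proof -
    have "2 * f u \<in> set vs" using black_at[OF that] UB by blast
    from Q_div[OF this] show ?thesis by simp
  qed
  have step: "f u \<in> orbit f w \<longleftrightarrow> u \<in> orbit f w" for u w
    using cyclic_on_f_in[OF f cyclic_on_orbit[OF f finite_atMost]] orbit.step by metis
  \<comment> \<open>Halving a vertex gives its label. A grey edge keeps the label, a black edge
    replaces it by its image or preimage; \<open>step\<close> covers both directions.\<close>
  have "vs ! j div 2 \<in> orbit f u0" if "j < length vs" for j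
    using that
  proof (induction j)
    case 0
    show ?case unfolding u0_def by (rule self_in_orbit[OF f finite_atMost])
  next
    case (Suc j)
    then have IH: "vs ! j div 2 \<in> orbit f u0" by simp
    show ?case
    proof (cases "even j")
      case True
      then obtain i where "j = 2 * i" by blast
      then have "{vs ! j, vs ! Suc j} \<in> black_part vs"
        using Suc.prems unfolding black_part_def by auto
      then obtain u where "{vs ! j, vs ! Suc j} = {2 * f u, 2 * u + 1}" using black by blast
      then have "vs ! j div 2 = f u \<and> vs ! Suc j div 2 = u \<or> vs ! j div 2 = u \<and> vs ! Suc j div 2 = f u"
        by (auto simp: doubleton_eq_iff)
      then show ?thesis using IH step by metis
    next
      case False
      then obtain i where "j = 2 * i + 1" by (blast elim: oddE)
      then have "{vs ! j, vs ! Suc j} \<in> grey_part vs"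
        using Suc.prems unfolding grey_part_def by (auto intro!: exI[of _ i])
      then obtain u where "{vs ! j, vs ! Suc j} = {2 * u, 2 * u + 1}"
        using grey unfolding grey_edges_def by blast
      then have "vs ! Suc j div 2 = vs ! j div 2"
        by (auto simp: doubleton_eq_iff)
      then show ?thesis using IH by simp
    qed
  qed
  note vs_orbit = this
  have "u \<in> orbit f u0" if u: "u \<in> Q" for u
  proof -
    obtain j where "j < length vs" "vs ! j = 2 * u + 1"
      using u by (auto simp: Q_def in_set_conv_nth)
    then show ?thesis using vs_orbit[of j] by simp
  qed
  moreover have "u \<in> Q" if "u \<in> orbit f u0" for u
    using that by induction (rule closed[OF u0], rule closed)
  ultimately have Q_eq: "Q = orbit f u0" by (intro equalityI subsetI)
  have "orbit f u0 \<in> orbits {..n} f" using Q_le[OF u0] by (simp add: orbits_def)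
  moreover have "orbit_cycle f (orbit f u0) = (black_part vs, grey_part vs)"
    unfolding orbit_cycle_def Q_eq[symmetric] black_image grey_image ..
  ultimately show ?thesis by (metis image_eqI)
qed

lemma orbit_alternating_list:
  assumes f: "f permutes {..n}" and Q: "Q \<in> orbits {..n} f"
  obtains vs where "vs \<noteq> []" "even (length vs)" "distinct vs"
    "orbit_cycle f Q = (black_part vs, grey_part vs)"
proof -
  obtain u where u: "u \<le> n" "Q = orbit f u" using Q by (auto simp: orbits_def)
  have self: "u \<in> orbit f u" by (rule self_in_orbit[OF f finite_atMost])
  define k where "k = funpow_dist1 f u u"
  define h where "h i = (f ^^ i) u" for i
  have k: "k > 0" by (simp add: k_def)
  have hk: "h k = h 0" using funpow_dist1_prop[OF self] by (simp add: h_def k_def)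
  have h_inj: "inj_on h {0..<k}" unfolding h_def k_def by (rule inj_on_funpow_dist1[OF self])
  have hQ: "h ` {0..<k} = Q" unfolding h_def k_def u by (rule orbit_conv_funpow_dist1[OF self, symmetric])
  have hSuc: "h (Suc i) = f (h i)" for i by (simp add: h_def)
  have fQ: "f ` Q = Q"
  proof (rule endo_inj_surj)
    show "finite Q" unfolding hQ[symmetric] by simp
    show "f ` Q \<subseteq> Q" unfolding u(2) by (intro image_subsetI orbit.step)
    show "inj_on f Q" by (rule permutes_inj_on[OF f])
  qed
  \<comment> \<open>The list runs \<open>2 * h 0 + 1\<close>, \<open>2 * h 1\<close>,
    \<open>2 * h 1 + 1\<close>, \<open>2 * h 2\<close> and so on, and closes up because
    \<open>h k = h 0\<close>.\<close>
  let ?v = "\<lambda>j. if even j then 2 * h (j div 2) + 1 else 2 * h (Suc (j div 2))"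
  define vs where "vs = map ?v [0..<2 * k]"
  have len: "length vs = 2 * k" by (simp add: vs_def)
  have nth: "vs ! (2 * i) = 2 * h i + 1" "vs ! (2 * i + 1) = 2 * f (h i)"  if "i < k" for i
    using that by (simp_all add: vs_def hSuc)
  have nth': "vs ! ((2 * i + 2) mod length vs) = 2 * f (h i) + 1" if "i < k" for i
  proof (cases "Suc i = k")
    case True
    then have "(2 * i + 2) mod length vs = 2 * 0" using len by auto
    then show ?thesis using nth(1)[OF k] hk hSuc[of i] True by simp
  next
    case False
    then have "(2 * i + 2) mod length vs = 2 * Suc i" using that len by simp
    then show ?thesis using nth(1)[of "Suc i"] hSuc[of i] that False by simp
  qed
  show thesis
  proof (rule that)
    show "vs \<noteq> []" "even (length vs)" using len k by auto
    show "distinct vs"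
      unfolding vs_def distinct_map
    proof (intro conjI inj_onI)
      fix i j assume ij: "i \<in> set [0..<2 * k]" "j \<in> set [0..<2 * k]" "?v i = ?v j"
      then have par: "even i \<longleftrightarrow> even j" by (auto split: if_splits) presburger+
      with ij(3) have "h (i div 2) = h (j div 2)"
        by (auto simp: hSuc inj_eq[OF permutes_inj[OF f]] split: if_splits)
      then have "i div 2 = j div 2" by (rule inj_onD[OF h_inj]) (use ij in auto)
      with par show "i = j" by presburger
    qed simp
    have "black_part vs = (\<lambda>i. {2 * h i + 1, 2 * f (h i)}) ` {0..<k}"
      unfolding black_part_def len using nth by (auto simp: image_iff; metis)
    also have "\<dots> = (\<lambda>u. {2 * f u, 2 * u + 1}) ` Q"
      unfolding hQ[symmetric] image_image by (simp add: insert_commute)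
    finally have black: "black_part vs = (\<lambda>u. {2 * f u, 2 * u + 1}) ` Q" .
    \<comment> \<open>Along the list the grey edges carry the labels \<open>f (h i)\<close>, which
      exhaust \<open>Q\<close> because \<open>f\<close> maps \<open>Q\<close> onto itself.\<close>
    have "grey_part vs = (\<lambda>i. {2 * f (h i), 2 * f (h i) + 1}) ` {0..<k}"
      unfolding grey_part_def using nth nth' len by (auto simp: image_iff; metis)
    also have "\<dots> = (\<lambda>u. {2 * u, 2 * u + 1}) ` f ` Q"
      unfolding hQ[symmetric] image_image by simp
    finally show "orbit_cycle f Q = (black_part vs, grey_part vs)"
      unfolding orbit_cycle_def black fQ by simp
  qed
qed

lemma bg_cycles_eq:
  assumes \<pi>: "\<pi> permutes {1..n}"
  shows "bg_cycles n \<pi> = orbit_cycle (left_of_succ \<pi>) ` orbits {..n} (left_of_succ \<pi>)"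
proof (intro equalityI subsetI)
  fix C assume "C \<in> bg_cycles n \<pi>"
  then show "C \<in> orbit_cycle (left_of_succ \<pi>) ` orbits {..n} (left_of_succ \<pi>)"
    using alternating_list_orbit[OF left_of_succ_permutes[OF \<pi>]]
    unfolding bg_cycles_def black_edges_eq[OF \<pi>] by blast
next
  let ?f = "left_of_succ \<pi>"
  note f = left_of_succ_permutes[OF \<pi>]
  fix C assume "C \<in> orbit_cycle ?f ` orbits {..n} ?f"
  then obtain Q where Q: "Q \<in> orbits {..n} ?f" "C = orbit_cycle ?f Q" by blast
  then have "Q \<subseteq> {..n}"
    using permutes_orbit_subset[OF f] by (auto simp: orbits_def)
  then have "fst C \<subseteq> black_edges n \<pi>" "snd C \<subseteq> grey_edges n"
    unfolding black_edges_eq[OF \<pi>] grey_edges_def Q(2) orbit_cycle_def by auto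
  moreover obtain vs where "vs \<noteq> []" "even (length vs)" "distinct vs"
      "orbit_cycle ?f Q = (black_part vs, grey_part vs)"
    using orbit_alternating_list[OF f Q(1)] .
  ultimately show "C \<in> bg_cycles n \<pi>"
    unfolding bg_cycles_def Q(2) by auto
qed

section \<open>Cycle counts as orbit counts\<close>

lemma inj_orbit_cycle: "inj (orbit_cycle f)"
proof -
  have "u \<in> Q \<longleftrightarrow> {2 * u, 2 * u + 1} \<in> snd (orbit_cycle f Q)" for u Q
    unfolding orbit_cycle_def using even_odd_pair_eq_iff by auto
  then show ?thesis by (intro injI set_eqI) metis
qed

lemma cycle_length_orbit_cycle: "cycle_length (orbit_cycle f Q) = card Q"
  unfolding cycle_length_def orbit_cycle_def fst_conv
  by (intro card_image inj_onI) (simp only: even_odd_pair_eq_iff)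

text \<open>Vertex 0 lies on the grey edge of label 0 and on the black edge of the label mapped to
  0; closure under \<open>f\<close> covers the latter case.\<close>

lemma is_leftmost_orbit_cycle:
  assumes "\<And>u. u \<in> Q \<Longrightarrow> f u \<in> Q"
  shows "is_leftmost (orbit_cycle f Q) \<longleftrightarrow> 0 \<in> Q"
  unfolding is_leftmost_def cycle_vertices_def orbit_cycle_def
  using assms by force

lemma num_cycles_eq:
  assumes "\<pi> permutes {1..n}"
  shows "num_cycles n \<pi> = card (orbits {..n} (left_of_succ \<pi>))"
  unfolding num_cycles_def bg_cycles_eq[OF assms]
  by (rule card_image) (rule inj_on_subset[OF inj_orbit_cycle subset_UNIV])

lemma num_nonleftmost_2_cycles_eq:
  assumes "\<pi> permutes {1..n}"
  shows "num_nonleftmost_2_cycles n \<pi> = short_orbits 2 n (left_of_succ \<pi>)"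
proof -
  let ?f = "left_of_succ \<pi>"
  have "is_leftmost (orbit_cycle ?f Q) \<longleftrightarrow> 0 \<in> Q" if "Q \<in> orbits {..n} ?f" for Q
    using that by (intro is_leftmost_orbit_cycle) (auto simp: orbits_def intro: orbit.step)
  then have "{C \<in> bg_cycles n \<pi>. cycle_length C = 2 \<and> \<not> is_leftmost C} =
      orbit_cycle ?f ` {Q \<in> orbits {..n} ?f. card Q = 2 \<and> 0 \<notin> Q}"
    unfolding bg_cycles_eq[OF assms] by (auto simp: cycle_length_orbit_cycle)
  then show ?thesis
    unfolding num_nonleftmost_2_cycles_def short_orbits_def
    by (simp add: card_image inj_on_subset[OF inj_orbit_cycle])
qed

text \<open>Only a 1-cycle at 0 is missing from \<open>short_orbits\<close>, and it exists exactly
  when \<open>f_val\<close> is 0, so one of the two always contributes 1.\<close>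

lemma num_1_cycles_eq:
  assumes "\<pi> permutes {1..n}"
  shows "num_k_cycles 1 n \<pi> + f_val \<pi> = short_orbits 1 n (left_of_succ \<pi>) + 1"
proof -
  let ?f = "left_of_succ \<pi>"
  note f = left_of_succ_permutes[OF assms]
  let ?A = "{Q \<in> orbits {..n} ?f. card Q = 1 \<and> 0 \<notin> Q}"
  have "{C \<in> bg_cycles n \<pi>. cycle_length C = 1} = orbit_cycle ?f ` {Q \<in> orbits {..n} ?f. card Q = 1}"
    unfolding bg_cycles_eq[OF assms] by (auto simp: cycle_length_orbit_cycle)
  then have "num_k_cycles 1 n \<pi> = card {Q \<in> orbits {..n} ?f. card Q = 1}"
    unfolding num_k_cycles_def by (simp add: card_image inj_on_subset[OF inj_orbit_cycle])
  also have "{Q \<in> orbits {..n} ?f. card Q = 1} = ?A \<union> (if ?f 0 = 0 then {{0}} else {})"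
  proof -
    have "Q \<in> ?A \<union> (if ?f 0 = 0 then {{0}} else {})" if Q: "Q \<in> orbits {..n} ?f" "card Q = 1" for Q
    proof (cases "0 \<in> Q")
      case True
      then have "Q = {0}" using Q(2) by (auto simp: card_1_singleton_iff)
      moreover have "orbit ?f 0 = Q"
        by (rule orbits_disjoint[OF f finite_atMost _ Q(1) _ True])
          (auto simp: orbits_def self_in_orbit[OF f finite_atMost])
      ultimately show ?thesis by (simp add: orbit_eq_singleton_iff)
    qed (use Q in simp)
    moreover have "{0} \<in> orbits {..n} ?f" if "?f 0 = 0"
      using that orbit_eq_singleton_iff[of ?f 0] unfolding orbits_def by (metis atMost_iff image_eqI le0)
    then have "(if ?f 0 = 0 then {{0}} else {}) \<subseteq> {Q \<in> orbits {..n} ?f. card Q = 1}" by simp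
    ultimately show ?thesis by blast
  qed
  also have "card \<dots> = card ?A + (if ?f 0 = 0 then 1 else 0)"
    by (simp add: finite_short_orbits)
  finally show ?thesis
    using left_of_succ_0_iff[OF assms] by (simp add: short_orbits_def f_val_def)
qed

theorem theorem4p4:
  fixes n :: nat and \<pi> :: "nat \<Rightarrow> nat"
  assumes "n \<ge> 1" and "\<pi> permutes {1..n}"
  shows "real (pbid n \<pi>)
           \<le> g_val n \<pi> - of_int \<lceil>real (num_nonleftmost_2_cycles n \<pi>) / 2\<rceil>"
proof -
  have "real (num_k_cycles 1 n \<pi>) + real (f_val \<pi>) = real (short_orbits 1 n (left_of_succ \<pi>)) + 1"
    using num_1_cycles_eq[OF assms(2)] by linarith
  then have "potential n (left_of_succ \<pi>) =
      g_val n \<pi> - of_int \<lceil>real (num_nonleftmost_2_cycles n \<pi>) / 2\<rceil>"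
    unfolding potential_def g_val_def num_cycles_eq[OF assms(2)] num_nonleftmost_2_cycles_eq[OF assms(2)]
    by (simp add: field_simps)
  then show ?thesis using pbid_le_potential[OF assms(2)] by simp
qed

end
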